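(* Let $\xi\in[0,1[$ and $\eta\in\mathbb R$, and let $p,q\colon[0,1[\to\mathbb R$ be continuous functions that are integrable on $[0,1[$, i.e. $\int_0^1|p(x)|\,dx<\infty$ and $\int_0^1|q(x)|\,dx<\infty$. Let $y\colon[0,1[\to\mathbb R$ be the solution of the Cauchy problem $y'+p(x)y=q(x)$ on $[0,1[$, $y(\xi)=\eta$. For all sufficiently large $n\in\mathbb N$, let $\overline{y}_n=\sum_{k=0}^{2^n-1}c_k\omega_k$ (with real $c_k$ depending on $n$) be the Walsh polynomial solving the discretized integral equation $$\overline{y}_n(x)=\eta+S_{2^n}\left(\int_{\xi}^{\cdot}\big(S_{2^n}q(t)-S_{2^n}p(t)\,\overline{y}_n(t)\big)\,dt\right)(x),\qquad x\in[0,1[.$$ Then $\overline{y}_n$ converges to $y$ uniformly on $[0,1[$ as $n\to\infty$, i.e. $\sup_{x\in[0,1[}|\overline{y}_n(x)-y(x)|\to0$.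
   Context: Under the stated hypotheses the discretized integral equation has exactly one solution of the indicated form for all sufficiently large $n$, so $\overline{y}_n$ is well defined for those $n$. Notation: $[0,1[$ is the half-open interval $\{x: 0\le x<1\}$. Each $x\in[0,1[$ is written as $x=\sum_{k=0}^\infty x_k2^{-(k+1)}$ with $x_k\in\{0,1\}$, where for dyadic rationals the expansion terminating in zeros is chosen. Each $n\in\mathbb N$ is written as $n=\sum_{k=0}^\infty n_k2^k$ with $n_k\in\{0,1\}$. The Rademacher functions are $r_k(x)=(-1)^{x_k}$, and the Walsh functions in the Paley enumeration are $\omega_n(x)=\prod_{k=0}^\infty r_k(x)^{n_k}$ ($x\in[0,1[$, $n\in\mathbb N=\{0,1,2,\dots\}$). For integrable $f$ on $[0,1[$, the Walsh-Fourier coefficients are $\widehat f_k=\int_0^1 f(x)\omega_k(x)\,dx$ and the partial sums are $S_mf(x)=\sum_{k=0}^{m-1}\widehat f_k\,\omega_k(x)$. Equivalently, $S_{2^n}f(x)=2^n\int_{I_n(x)}f(y)\,dy$, where $I_n(x)$ is the dyadic interval $[\frac{i-1}{2^n},\frac{i}{2^n}[$ ($1\le i\le 2^n$) containing $x$. In the equation, $S_{2^n}$ is applied to the function $s\mapsto\int_\xi^s(\cdots)\,dt$ on $[0,1[$, with the usual oriented-integral convention $\int_\xi^s=-\int_s^\xi$ when $s<\xi$. When $\xi=0$ or at the endpoint $x=0$, the derivative in the Cauchy problem is one-sided; the Cauchy problem is equivalent to the integral equation $y(x)=\eta+\int_\xi^x (q(t)-p(t)y(t))\,dt$, $x\in[0,1[$,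 for continuous $y$. *)

theory Defs
  imports "HOL-Analysis.Analysis"
begin

(* For dyadic rationals the floor selects the expansion terminating in zeros. *)
definition dyadic_digit :: "nat \<Rightarrow> real \<Rightarrow> nat" where
  "dyadic_digit k x = nat (\<lfloor>2 ^ Suc k * x\<rfloor> mod 2)"

definition binary_digit :: "nat \<Rightarrow> nat \<Rightarrow> nat" where
  "binary_digit k n = n div 2 ^ k mod 2"

lemma dyadic_digit_sums:
  assumes "0 \<le> x" "x < 1"
  shows "(\<lambda>k. real (dyadic_digit k x) / 2 ^ Suc k) sums x"
proof -
  define a where "a n = real_of_int \<lfloor>2 ^ n * x\<rfloor> / 2 ^ n" for n :: nat
  have digit: "real (dyadic_digit k x) / 2 ^ Suc k = a (Suc k) - a k" for k
  proof -
    have "\<lfloor>2 ^ k * x\<rfloor> = \<lfloor>2 ^ Suc k * x\<rfloor> div 2"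
      using floor_divide_real_eq_div[of 2 "2 ^ Suc k * x"] by simp
    then have "\<lfloor>2 ^ Suc k * x\<rfloor> = 2 * \<lfloor>2 ^ k * x\<rfloor> + \<lfloor>2 ^ Suc k * x\<rfloor> mod 2"
      by simp
    then have "real_of_int \<lfloor>2 ^ Suc k * x\<rfloor>
        = 2 * real_of_int \<lfloor>2 ^ k * x\<rfloor> + real_of_int (\<lfloor>2 ^ Suc k * x\<rfloor> mod 2)"
      by linarith
    moreover have "real (dyadic_digit k x) = real_of_int (\<lfloor>2 ^ Suc k * x\<rfloor> mod 2)"
      unfolding dyadic_digit_def by simp
    ultimately show ?thesis
      unfolding a_def by (simp add: field_simps)
  qed
  have lower: "x - 1 / 2 ^ n \<le> a n" and upper: "a n \<le> x" for n
  proof -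
    have "2 ^ n * x - 1 \<le> real_of_int \<lfloor>2 ^ n * x\<rfloor>"
      by linarith
    then have "(2 ^ n * x - 1) / 2 ^ n \<le> a n"
      unfolding a_def by (rule divide_right_mono) simp
    then show "x - 1 / 2 ^ n \<le> a n"
      by (simp add: diff_divide_distrib)
    have "real_of_int \<lfloor>2 ^ n * x\<rfloor> \<le> 2 ^ n * x"
      by linarith
    then show "a n \<le> x"
      by (simp add: a_def field_simps)
  qed
  have "(\<lambda>n. x - 1 / 2 ^ n) \<longlonglongrightarrow> x - 0"
    by (intro tendsto_diff tendsto_const LIMSEQ_divide_realpow_zero) simp
  then have "a \<longlonglongrightarrow> x"
    by (intro tendsto_sandwich[of "\<lambda>n. x - 1 / 2 ^ n" a sequentially "\<lambda>_. x"])
       (simp_all add: lower upper)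
  moreover have "a 0 = 0"
    using assms by (simp add: a_def floor_eq_iff)
  ultimately show ?thesis
    using telescope_sums[of a x] unfolding digit by simp
qed

lemma dyadic_digit_dyadic_rational:
  assumes "n \<le> k"
  shows "dyadic_digit k (real i / 2 ^ n) = 0"
proof -
  have "(2::real) ^ Suc k = 2 ^ n * 2 ^ (k - n) * 2"
    using assms by (simp flip: power_add)
  then have "2 ^ Suc k * (real i / 2 ^ n) = real_of_int (2 * (2 ^ (k - n) * int i))"
    by simp
  then have "\<lfloor>2 ^ Suc k * (real i / 2 ^ n)\<rfloor> = 2 * (2 ^ (k - n) * int i)"
    by (simp only: floor_of_int)
  then show ?thesis
    by (simp add: dyadic_digit_def)
qed

definition rademacher :: "nat \<Rightarrow> real \<Rightarrow> real" where
  "rademacher k x = (-1) ^ dyadic_digit k x"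

(* Paley enumeration; all but finitely many factors equal 1. *)
definition walsh :: "nat \<Rightarrow> real \<Rightarrow> real" where
  "walsh n x = (\<Prod>k. rademacher k x ^ binary_digit k n)"

definition walsh_coeff :: "(real \<Rightarrow> real) \<Rightarrow> nat \<Rightarrow> real" where
  "walsh_coeff f k = (LBINT x:{0..<1}. f x * walsh k x)"

definition walsh_psum :: "nat \<Rightarrow> (real \<Rightarrow> real) \<Rightarrow> real \<Rightarrow> real" where
  "walsh_psum m f x = (\<Sum>k<m. walsh_coeff f k * walsh k x)"

definition walsh_poly :: "nat \<Rightarrow> (nat \<Rightarrow> real) \<Rightarrow> real \<Rightarrow> real" where
  "walsh_poly m c x = (\<Sum>k<m. c k * walsh k x)"

(* The interval integral is oriented: it changes sign when s < \<xi>. *)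
definition solves_discretized_eq ::
  "(real \<Rightarrow> real) \<Rightarrow> (real \<Rightarrow> real) \<Rightarrow> real \<Rightarrow> real \<Rightarrow> nat \<Rightarrow> (real \<Rightarrow> real) \<Rightarrow> bool" where
  "solves_discretized_eq p q \<xi> \<eta> n u \<longleftrightarrow>
     (\<forall>x\<in>{0..<1}. u x = \<eta> +
        walsh_psum (2 ^ n)
          (\<lambda>s. LBINT t=ereal \<xi>..ereal s. walsh_psum (2 ^ n) q t - walsh_psum (2 ^ n) p t * u t) x)"

end

theory Submission imports Defs begin

text \<open>
  Write \<open>S\<close> for the Walsh partial sum of order \<open>2 ^ n\<close>. The Dirichlet kernel of this order is \<open>2 ^ n\<close> times
  the indicator of the dyadic cell, so \<open>S f\<close> replaces \<open>f\<close> by its mean on each dyadic cell of length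
  \<open>1 / 2 ^ n\<close> (\<open>walsh_psum_eq_mean\<close>), and every Walsh polynomial of that order is constant on cells.

  Let \<open>u\<close> be the discrete solution and \<open>w = \<eta> + \<integral>\<^sub>\<xi> (S q - S p u)\<close>, so that \<open>u = S w\<close>. Let \<open>\<delta>\<close> bound
  the integrals of \<open>\<bar>p\<bar>\<close> and \<open>\<bar>q\<bar>\<close> over single cells; it tends to \<open>0\<close> by uniform continuity of the
  primitives (\<open>eventually_cell_integrals_small\<close>). If \<open>\<bar>u\<bar> \<le> B\<close>, then \<open>w\<close> oscillates by at most
  \<open>\<delta> (1 + B)\<close> on a cell, so \<open>u\<close> and \<open>w\<close> are that close. Moreover, \<open>w\<close> almost solves the
  integral equation of \<open>y\<close>: replacing \<open>S q - S p u\<close> by \<open>q - p u\<close> changes the integrand by a function of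
  mean zero on every cell, so only the incomplete cells at the endpoints of integration matter
  (\<open>primitive_increment_le_of_cell_mean_zero\<close>). Stability of the linear Volterra equation
  \<open>z + \<integral>\<^sub>\<xi> p z = r\<close> (\<open>volterra_stability\<close>) then yields \<open>\<bar>u - y\<bar> \<le> K \<delta> (1 + B)\<close> with a constant
  \<open>K\<close> depending on \<open>\<integral>\<bar>p\<bar>\<close> only (\<open>discretization_error\<close>).

  Finally \<open>B\<close> is eliminated: with \<open>B\<close> the supremum of \<open>\<bar>u\<bar>\<close> and \<open>Y\<close> a bound on
  \<open>\<bar>y\<bar>\<close>, the estimate gives \<open>B \<le> Y + K \<delta> (1 + B)\<close>, which bounds \<open>B\<close> by \<open>2 Y + 1\<close> as soon as
  \<open>K \<delta> \<le> 1 / 2\<close>. Hence the error is \<open>O(\<delta>)\<close>.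
\<close>

section \<open>Primitives of integrable functions\<close>

text \<open>All oriented integrals are written as increments of the primitive starting at \<open>0\<close>: increments
  add up along adjacent intervals whatever the order of their endpoints, which treats \<open>x < \<xi>\<close> and
  \<open>x \<ge> \<xi>\<close> alike.\<close>

definition primitive :: "(real \<Rightarrow> real) \<Rightarrow> real \<Rightarrow> real" where
  "primitive f x = (LBINT t:{0..<x}. f t)"

abbreviation integrable01 :: "(real \<Rightarrow> real) \<Rightarrow> bool" where
  "integrable01 f \<equiv> set_integrable lborel {0..<1} f"

lemma primitive_increment:
  assumes f: "integrable01 f" and ab: "0 \<le> a" "a \<le> b" "b \<le> 1"
  shows "primitive f b - primitive f a = (LBINT t:{a..<b}. f t)"
proof -
  have "{0..<b} = {0..<a} \<union> {a..<b}"
    using ab by auto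
  moreover have "set_integrable lborel {0..<a} f" "set_integrable lborel {a..<b} f"
    using ab by (auto intro: set_integrable_subset[OF f])
  ultimately show ?thesis
    unfolding primitive_def by (simp add: set_integral_Un)
qed

lemma interval_integral_eq_primitive:
  assumes f: "integrable01 f" and "0 \<le> a" "a \<le> 1" "0 \<le> b" "b \<le> 1"
  shows "(LBINT t=ereal a..ereal b. f t) = primitive f b - primitive f a"
proof (cases "a \<le> b")
  case True
  then show ?thesis
    using assms by (simp add: interval_integral_Ico primitive_increment)
next
  case False
  then have "(LBINT t=ereal b..ereal a. f t) = primitive f a - primitive f b"
    using assms by (simp add: interval_integral_Ico primitive_increment)
  then show ?thesis
    by (subst interval_integral_endpoints_reverse) simp
qed

lemma
  assumes f: "integrable01 f" and g: "integrable01 g" and x: "0 \<le> x" "x \<le> 1"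
  shows primitive_add: "primitive (\<lambda>t. f t + g t) x = primitive f x + primitive g x"
    and primitive_diff: "primitive (\<lambda>t. f t - g t) x = primitive f x - primitive g x"
proof -
  have "set_integrable lborel {0..<x} f" "set_integrable lborel {0..<x} g"
    using x by (auto intro: set_integrable_subset[OF f] set_integrable_subset[OF g])
  then show "primitive (\<lambda>t. f t + g t) x = primitive f x + primitive g x"
    "primitive (\<lambda>t. f t - g t) x = primitive f x - primitive g x"
    unfolding primitive_def by auto
qed

lemma primitive_cmult: "primitive (\<lambda>t. c * f t) x = c * primitive f x"
  by (simp add: primitive_def)

lemma integrable01_const: "integrable01 (\<lambda>_. c)"
  unfolding set_integrable_def by simp

lemma primitive_const: "0 \<le> x \<Longrightarrow> primitive (\<lambda>_. c) x = c * x"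
  unfolding primitive_def by (subst set_integral_const) auto

lemma primitive_increment_mono:
  assumes f: "integrable01 f" and g: "integrable01 g" and ab: "0 \<le> a" "a \<le> b" "b \<le> 1"
    and le: "\<And>t. a \<le> t \<Longrightarrow> t < b \<Longrightarrow> f t \<le> g t"
  shows "primitive f b - primitive f a \<le> primitive g b - primitive g a"
  using ab le
  by (auto simp: primitive_increment f g intro!: set_integral_mono set_integrable_subset[OF f] set_integrable_subset[OF g])

lemma primitive_increment_cong:
  assumes f: "integrable01 f" and g: "integrable01 g" and ab: "0 \<le> a" "a \<le> b" "b \<le> 1"
    and "\<And>t. a \<le> t \<Longrightarrow> t < b \<Longrightarrow> f t = g t"
  shows "primitive f b - primitive f a = primitive g b - primitive g a"
  using primitive_increment_mono[OF f g ab] primitive_increment_mono[OF g f ab] assms by fastforce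

lemma abs_primitive_increment_le:
  assumes f: "integrable01 f" and g: "integrable01 g" and ab: "0 \<le> a" "a \<le> b" "b \<le> 1"
    and le: "\<And>t. a \<le> t \<Longrightarrow> t < b \<Longrightarrow> \<bar>f t\<bar> \<le> g t"
  shows "\<bar>primitive f b - primitive f a\<bar> \<le> primitive g b - primitive g a"
proof -
  have "primitive f b - primitive f a \<le> primitive g b - primitive g a"
    by (rule primitive_increment_mono[OF f g ab]) (use le in force)
  moreover have "primitive (\<lambda>t. - 1 * f t) b - primitive (\<lambda>t. - 1 * f t) a \<le> primitive g b - primitive g a"
    using le f by (intro primitive_increment_mono[OF _ g ab] set_integrable_mult_right) (auto simp: abs_le_iff)
  ultimately show ?thesis
    unfolding primitive_cmult by linarith
qed

lemma primitive_zero: "primitive f 0 = 0"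
  by (simp add: primitive_def set_lebesgue_integral_def)

lemma primitive_increment_le_total:
  assumes f: "integrable01 f" "integrable01 g"
    and le: "\<And>t. 0 \<le> t \<Longrightarrow> t < 1 \<Longrightarrow> \<bar>f t\<bar> \<le> g t"
    and ab: "0 \<le> a" "a \<le> 1" "0 \<le> b" "b \<le> 1"
  shows "\<bar>primitive f b - primitive f a\<bar> \<le> primitive g 1"
proof -
  have *: "\<bar>primitive f b - primitive f a\<bar> \<le> primitive g 1" if "0 \<le> a" "a \<le> b" "b \<le> 1" for a b
  proof -
    have nonneg: "g t \<ge> 0" if "0 \<le> t" "t < 1" for t
      using le[OF that] by linarith
    have "\<bar>primitive f b - primitive f a\<bar> \<le> primitive g b - primitive g a"
      by (rule abs_primitive_increment_le) (use that f le in auto)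
    moreover have "primitive (\<lambda>_. 0) a - primitive (\<lambda>_. 0) 0 \<le> primitive g a - primitive g 0"
      by (rule primitive_increment_mono) (use that f nonneg integrable01_const in auto)
    moreover have "primitive (\<lambda>_. 0) 1 - primitive (\<lambda>_. 0) b \<le> primitive g 1 - primitive g b"
      by (rule primitive_increment_mono) (use that f nonneg integrable01_const in auto)
    ultimately show ?thesis
      using that by (simp add: primitive_const primitive_zero)
  qed
  show ?thesis
    using *[of a b] *[of b a] ab by (cases "a \<le> b") auto
qed

text \<open>The right endpoint belongs to the domain of continuity although \<open>f\<close> may be unbounded near it.
  Compactness of \<open>{0..1}\<close> then makes the primitive uniformly continuous, which is what makes
  integrals over short intervals uniformly small.\<close>

lemma continuous_on_primitive:
  assumes f: "integrable01 f"
  shows "continuous_on {0..1} (primitive f)"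
proof -
  \<comment> \<open>The integrability hypothesis says nothing about \<open>f\<close> at \<open>1\<close>; \<open>F\<close> has the value \<open>0\<close> there.\<close>
  define F where "F t = indicator {0..<1} t * f t" for t
  have F: "set_integrable lborel {0..1} F"
    using f unfolding set_integrable_def F_def
    by (rule Bochner_Integration.integrable_cong[THEN iffD1, rotated -1]) (auto simp: indicator_def)
  have "primitive f x = integral {0..x} F" if x: "x \<in> {0..1}" for x
  proof -
    have "primitive f x = (LBINT t:{0..<x}. F t)"
      unfolding primitive_def F_def using x by (intro set_lebesgue_integral_cong) auto
    also have "\<dots> = (LBINT t:{0..x}. F t)"
      using x interval_integral_Ico[of 0 x F] interval_integral_Icc[of 0 x F]
      by (simp add: zero_ereal_def)
    also have "\<dots> = integral {0..x} F"
      using x by (intro set_borel_integral_eq_integral set_integrable_subset[OF F]) auto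
    finally show ?thesis .
  qed
  moreover have "continuous_on {0..1} (\<lambda>x. integral {0..x} F)"
    by (intro indefinite_integral_continuous_1 set_borel_integral_eq_integral F)
  ultimately show ?thesis
    by (subst continuous_on_cong[OF refl, of _ _ "\<lambda>x. integral {0..x} F"]) auto
qed

lemma primitive_has_derivative:
  assumes f: "integrable01 f" and cont: "continuous_on {0..<1} f" and x: "x \<in> {0..<1}"
  shows "(primitive f has_real_derivative f x) (at x within {0..<1})"
proof -
  \<comment> \<open>Continuity of \<open>f\<close> is needed on a compact interval that contains a one-sided neighbourhood of \<open>x\<close>.\<close>
  define b where "b = (x + 1) / 2"
  have b: "x < b" "b < 1" "0 \<le> x"
    using x by (auto simp: b_def)
  have "((\<lambda>u. LBINT y=ereal 0..ereal u. f y) has_vector_derivative f x) (at x within {0..b})"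
    using b by (intro interval_integral_FTC2 continuous_on_subset[OF cont]) auto
  then have "((\<lambda>u. LBINT y=ereal 0..ereal u. f y) has_real_derivative f x) (at x within {0..b})"
    by (simp add: has_real_derivative_iff_has_vector_derivative)
  then have "(primitive f has_real_derivative f x) (at x within {0..b})"
    by (rule has_field_derivative_transform_within[OF _ zero_less_one])
       (use b in \<open>auto simp: interval_integral_eq_primitive[OF f] primitive_zero\<close>)
  moreover have "at x within {0..b} = at x within {0..<1}"
    by (rule at_within_nhd[of _ "{..<b}"]) (use b in auto)
  ultimately show ?thesis
    by simp
qed

lemma integrable01_continuous:
  assumes "continuous_on {0..1} f"
  shows "integrable01 f"
  by (rule set_integrable_subset[OF borel_integrable_atLeastAtMost'[OF assms]]) auto

lemma integrable01_mult_bounded_continuous: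
  assumes f: "integrable01 f" and g: "continuous_on {0..<1} g"
    and le: "\<And>t. t \<in> {0..<1} \<Longrightarrow> \<bar>g t\<bar> \<le> C"
  shows "integrable01 (\<lambda>t. f t * g t)"
proof (rule set_integrable_bound)
  show "integrable01 (\<lambda>t. C * f t)"
    using f by (rule set_integrable_mult_right)
  have [measurable]: "(\<lambda>t. indicator {0..<1} t *\<^sub>R f t) \<in> borel_measurable borel"
    using f borel_measurable_integrable unfolding set_integrable_def by fastforce
  have [measurable]: "(\<lambda>t. indicator {0..<1} t *\<^sub>R g t) \<in> borel_measurable borel"
    by (rule borel_measurable_continuous_on_indicator[OF _ g]) simp
  have "(\<lambda>t. (indicator {0..<1} t *\<^sub>R f t) * (indicator {0..<1} t *\<^sub>R g t)) \<in> borel_measurable borel"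
    by measurable
  also have "(\<lambda>t. (indicator {0..<1} t *\<^sub>R f t) * (indicator {0..<1} t *\<^sub>R g t))
      = (\<lambda>t. indicator {0..<1} t *\<^sub>R (f t * g t))"
    by (auto simp: indicator_def)
  finally show "set_borel_measurable lborel {0..<1} (\<lambda>t. f t * g t)"
    unfolding set_borel_measurable_def by simp
  show "AE t in lborel. t \<in> {0..<1} \<longrightarrow> norm (f t * g t) \<le> norm (C * f t)"
  proof (intro AE_I2 impI)
    fix t :: real assume "t \<in> {0..<1}"
    then have "\<bar>g t\<bar> * \<bar>f t\<bar> \<le> \<bar>C\<bar> * \<bar>f t\<bar>"
      using le[of t] by (intro mult_right_mono) auto
    then show "norm (f t * g t) \<le> norm (C * f t)"
      by (simp add: abs_mult mult.commute)
  qed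
qed

section \<open>Stability of a linear Volterra equation\<close>

text \<open>A mean value inequality without integrals: both \<open>g + f\<close> and \<open>g - f\<close> have a nonnegative
  derivative, hence are nondecreasing.\<close>

lemma abs_increment_le_of_derivative:
  fixes f g :: "real \<Rightarrow> real"
  assumes f: "\<And>x. x \<in> {0..<1} \<Longrightarrow> (f has_real_derivative f' x) (at x within {0..<1})"
    and g: "\<And>x. x \<in> {0..<1} \<Longrightarrow> (g has_real_derivative g' x) (at x within {0..<1})"
    and le: "\<And>x. x \<in> {0..<1} \<Longrightarrow> \<bar>f' x\<bar> \<le> g' x"
    and ab: "a \<in> {0..<1}" "b \<in> {0..<1}" 
  shows "\<bar>f b - f a\<bar> \<le> \<bar>g b - g a\<bar>"
proof -
  have mono: "g a + c * f a \<le> g b + c * f b"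
    if ab: "0 \<le> a" "a \<le> b" "b < 1" and c: "c = 1 \<or> c = -1" for a b c
  proof (rule DERIV_nonneg_imp_increasing_open[OF ab(2)])
    fix x assume x: "a < x" "x < b"
    have "((\<lambda>x. g x + c * f x) has_real_derivative g' x + c * f' x) (at x within {0..<1})"
      using x ab by (auto intro!: derivative_eq_intros f g)
    then have "((\<lambda>x. g x + c * f x) has_real_derivative g' x + c * f' x) (at x within {0<..<1})"
      by (rule DERIV_subset) auto
    then have "((\<lambda>x. g x + c * f x) has_real_derivative g' x + c * f' x) (at x)"
      using x ab by (subst (asm) at_within_open) auto
    moreover have "g' x + c * f' x \<ge> 0"
      using le[of x] x ab c by auto
    ultimately show "\<exists>d. ((\<lambda>x. g x + c * f x) has_real_derivative d) (at x) \<and> d \<ge> 0"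
      by blast
  next
    have "continuous_on {0..<1} f" "continuous_on {0..<1} g"
      using f g by (blast intro: DERIV_continuous_on)+
    then show "continuous_on {a..b} (\<lambda>x. g x + c * f x)"
      using ab by (intro continuous_intros) (auto elim!: continuous_on_subset)
  qed
  show ?thesis
    using mono[of a b 1] mono[of a b "-1"] mono[of b a 1] mono[of b a "-1"] ab
    by (cases "a \<le> b") auto
qed

text \<open>With the integrating factor \<open>E = exp (\<integral>\<^sub>\<xi> p)\<close> the integral term \<open>g = \<integral>\<^sub>\<xi> p z\<close> satisfies
  \<open>(E g)' = E p (z + g)\<close>, whose absolute value is at most \<open>exp P * a * \<bar>p\<bar>\<close>; comparing with the
  primitive of \<open>\<bar>p\<bar>\<close> bounds \<open>g\<close>. This takes the place of Gronwall's inequality and treats both sides of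
  \<open>\<xi>\<close> alike. The term \<open>g\<close> is given through its derivative because one application is to the exact
  solution, before \<open>p z\<close> is known to be integrable up to \<open>1\<close>.\<close>

lemma volterra_stability:
  fixes z g p :: "real \<Rightarrow> real"
  assumes p: "integrable01 p" "continuous_on {0..<1} p"
    and \<xi>: "\<xi> \<in> {0..<1}" and g0: "g \<xi> = 0"
    and g: "\<And>x. x \<in> {0..<1} \<Longrightarrow> (g has_real_derivative p x * z x) (at x within {0..<1})"
    and le: "\<And>x. x \<in> {0..<1} \<Longrightarrow> \<bar>z x + g x\<bar> \<le> a"
    and x: "x \<in> {0..<1}"
  defines "P \<equiv> primitive (\<lambda>t. \<bar>p t\<bar>) 1"
  shows "\<bar>z x\<bar> \<le> (1 + P * exp (2 * P)) * a"
proof -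
  define E where "E x = exp (primitive p x - primitive p \<xi>)" for x
  have p': "integrable01 (\<lambda>t. \<bar>p t\<bar>)" "continuous_on {0..<1} (\<lambda>t. \<bar>p t\<bar>)"
    using p by (auto intro: set_integrable_abs continuous_intros)
  have a: "a \<ge> 0"
    using le[OF \<xi>] by linarith
  have E_exponent: "\<bar>primitive p x - primitive p \<xi>\<bar> \<le> P" if "x \<in> {0..<1}" for x
    unfolding P_def by (rule primitive_increment_le_total) (use p p' \<xi> that in auto)
  have E: "E x \<le> exp P" if "x \<in> {0..<1}" for x
    using E_exponent[OF that] by (simp add: E_def)
  have "\<bar>E x * g x - E \<xi> * g \<xi>\<bar> \<le> \<bar>exp P * a * primitive (\<lambda>t. \<bar>p t\<bar>) x - exp P * a * primitive (\<lambda>t. \<bar>p t\<bar>) \<xi>\<bar>"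
  proof (rule abs_increment_le_of_derivative[where f = "\<lambda>x. E x * g x" and f' = "\<lambda>x. E x * p x * (z x + g x)"
        and g = "\<lambda>x. exp P * a * primitive (\<lambda>t. \<bar>p t\<bar>) x" and g' = "\<lambda>x. exp P * a * \<bar>p x\<bar>"])
    fix x :: real assume x: "x \<in> {0..<1}"
    show "((\<lambda>x. E x * g x) has_real_derivative E x * p x * (z x + g x)) (at x within {0..<1})"
      unfolding E_def using x
      by (auto intro!: derivative_eq_intros primitive_has_derivative p g simp: algebra_simps)
    show "((\<lambda>x. exp P * a * primitive (\<lambda>t. \<bar>p t\<bar>) x) has_real_derivative exp P * a * \<bar>p x\<bar>) (at x within {0..<1})"
      using primitive_has_derivative[OF p' x] by (rule DERIV_cmult)
    have "\<bar>E x * p x * (z x + g x)\<bar> = E x * \<bar>z x + g x\<bar> * \<bar>p x\<bar>"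
      by (simp add: abs_mult E_def)
    also have "\<dots> \<le> exp P * a * \<bar>p x\<bar>"
      using E[OF x] le[OF x] a by (intro mult_mono) auto
    finally show "\<bar>E x * p x * (z x + g x)\<bar> \<le> exp P * a * \<bar>p x\<bar>" .
  qed (use x \<xi> in auto)
  also have "\<dots> = exp P * a * \<bar>primitive (\<lambda>t. \<bar>p t\<bar>) x - primitive (\<lambda>t. \<bar>p t\<bar>) \<xi>\<bar>"
    using a by (simp add: abs_mult flip: right_diff_distrib)
  also have "\<dots> \<le> exp P * a * P"
    unfolding P_def using a
    by (intro mult_left_mono primitive_increment_le_total) (use p' x \<xi> in auto)
  finally have Eg: "E x * \<bar>g x\<bar> \<le> exp P * a * P"
    by (simp add: g0 abs_mult E_def)
  have "exp (- P) \<le> E x"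
    using E_exponent[OF x] by (simp add: E_def)
  then have "exp (- P) * \<bar>g x\<bar> \<le> exp P * a * P"
    using Eg by (meson abs_ge_zero mult_right_mono order_trans)
  then have "exp P * (exp (- P) * \<bar>g x\<bar>) \<le> exp P * (exp P * a * P)"
    by (rule mult_left_mono) simp
  moreover have "exp P * (exp (- P) * \<bar>g x\<bar>) = \<bar>g x\<bar>"
    by (simp add: exp_minus)
  ultimately have "\<bar>g x\<bar> \<le> exp P * (exp P * a * P)"
    by (simp only:)
  also have "\<dots> = P * exp (2 * P) * a"
    unfolding mult_2 exp_add by (simp only: ac_simps)
  finally have "\<bar>g x\<bar> \<le> P * exp (2 * P) * a" .
  then show ?thesis
    using le[OF x] by (simp add: algebra_simps)
qed

section \<open>Walsh partial sums as means over dyadic cells\<close>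

lemma floor_double_power: "\<lfloor>2 ^ Suc n * x\<rfloor> = 2 * \<lfloor>2 ^ n * x\<rfloor> + int (dyadic_digit n x)"
proof -
  have "\<lfloor>2 ^ n * x\<rfloor> = \<lfloor>2 ^ Suc n * x\<rfloor> div 2"
    using floor_divide_real_eq_div[of 2 "2 ^ Suc n * x"] by simp
  then show ?thesis
    unfolding dyadic_digit_def by simp
qed

lemma dyadic_digit_less_2: "dyadic_digit n x < 2"
  unfolding dyadic_digit_def by (simp add: nat_less_iff)

lemma rademacher_eq_iff: "rademacher n x = rademacher n t \<longleftrightarrow> dyadic_digit n x = dyadic_digit n t"
  using dyadic_digit_less_2[of n x] dyadic_digit_less_2[of n t]
  by (auto simp: rademacher_def less_2_cases_iff)

lemma rademacher_cases: "rademacher n x = 1 \<or> rademacher n x = -1"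
  using dyadic_digit_less_2[of n x] by (auto simp: rademacher_def less_2_cases_iff)

text \<open>The dyadic cells of order \<open>n\<close> are the level sets of \<open>\<lfloor>2 ^ n * x\<rfloor>\<close>; passing to the next order
  splits each of them according to the next Rademacher function.\<close>

lemma floor_power_Suc_eq_iff:
  "\<lfloor>2 ^ Suc n * x\<rfloor> = \<lfloor>2 ^ Suc n * t\<rfloor> \<longleftrightarrow>
     \<lfloor>2 ^ n * x\<rfloor> = \<lfloor>2 ^ n * t\<rfloor> \<and> rademacher n x = rademacher n t"
  using dyadic_digit_less_2[of n x] dyadic_digit_less_2[of n t]
  unfolding floor_double_power rademacher_eq_iff by presburger

lemma rademacher_eq_of_floor_eq:
  assumes "\<lfloor>2 ^ n * x\<rfloor> = \<lfloor>2 ^ n * t\<rfloor>" "j < n"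
  shows "rademacher j x = rademacher j t"
  using assms by (induction n) (auto simp: floor_power_Suc_eq_iff less_Suc_eq simp del: power_Suc)

lemma walsh_eq_prod:
  assumes "k < 2 ^ n"
  shows "walsh k x = (\<Prod>j<n. rademacher j x ^ binary_digit j k)"
  unfolding walsh_def
proof (rule prodinf_finite)
  fix j assume "j \<notin> {..<n}"
  then have "(2::nat) ^ n \<le> 2 ^ j"
    by simp
  with assms have "k < 2 ^ j"
    by (rule less_le_trans)
  then show "rademacher j x ^ binary_digit j k = 1"
    by (simp add: binary_digit_def)
qed simp

text \<open>Expanding \<open>\<Prod>(1 + a\<^sub>j)\<close> gives one term for each set of indices \<open>j < n\<close>, and the binary
  expansions of the numbers below \<open>2 ^ n\<close> enumerate these sets.\<close>

lemma sum_prod_binary_digits: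
  fixes a :: "nat \<Rightarrow> real"
  shows "(\<Sum>k<2 ^ n. \<Prod>j<n. a j ^ binary_digit j k) = (\<Prod>j<n. 1 + a j)"
proof (induction n)
  case (Suc n)
  let ?\<pi> = "\<lambda>k. \<Prod>j<n. a j ^ binary_digit j k"
  have low: "binary_digit j (k + 2 ^ n) = binary_digit j k" if "j < n" for j k
  proof -
    have "(k + 2 ^ n) div 2 ^ j = k div 2 ^ j + 2 * 2 ^ (n - Suc j)"
    proof -
      have "(2::nat) ^ n = 2 * 2 ^ (n - Suc j) * 2 ^ j"
        using that by (simp flip: power_add power_Suc)
      then show ?thesis
        by simp
    qed
    then show ?thesis
      by (simp add: binary_digit_def)
  qed
  let ?f = "\<lambda>k. \<Prod>j<Suc n. a j ^ binary_digit j k"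
  have "sum ?f {..<2 ^ Suc n} = sum ?f {0..<2 ^ n} + sum ?f {2 ^ n..<2 ^ n + 2 ^ n}"
    by (subst sum.atLeastLessThan_concat) (simp_all add: atLeast0LessThan mult_2)
  also have "sum ?f {2 ^ n..<2 ^ n + 2 ^ n} = (\<Sum>k<2 ^ n. ?f (k + 2 ^ n))"
    using sum.shift_bounds_nat_ivl[of ?f 0 "2 ^ n" "2 ^ n"]
    by (simp only: add_0 atLeast0LessThan)
  also have "sum ?f {0..<2 ^ n} = (\<Sum>k<2 ^ n. ?\<pi> k)"
    by (rule sum.cong) (auto simp: binary_digit_def)
  also have "(\<Sum>k<2 ^ n. ?f (k + 2 ^ n)) = (\<Sum>k<2 ^ n. ?\<pi> k * a n)"
  proof (rule sum.cong[OF refl])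
    fix k :: nat assume "k \<in> {..<2 ^ n}"
    then have "binary_digit n (k + 2 ^ n) = 1"
      by (simp add: binary_digit_def)
    moreover have "(\<Prod>j<n. a j ^ binary_digit j (k + 2 ^ n)) = ?\<pi> k"
      by (rule prod.cong) (simp_all add: low)
    ultimately show "?f (k + 2 ^ n) = ?\<pi> k * a n"
      by simp
  qed
  also have "(\<Sum>k<2 ^ n. ?\<pi> k) + (\<Sum>k<2 ^ n. ?\<pi> k * a n) = (\<Sum>k<2 ^ n. ?\<pi> k) * (1 + a n)"
    by (simp add: distrib_left flip: sum_distrib_right)
  finally show ?case
    by (simp add: Suc.IH)
qed simp

text \<open>The Dirichlet kernel of order \<open>2 ^ n\<close> factors as \<open>\<Prod>(1 + r\<^sub>j(t) r\<^sub>j(x))\<close>. Each factor is \<open>2\<close> if the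
  \<open>j\<close>-th digits agree and \<open>0\<close> otherwise, so the kernel is supported on the cell of \<open>x\<close>.\<close>

lemma walsh_dirichlet_kernel:
  assumes "x \<in> {0..<1}" "t \<in> {0..<1}"
  shows "(\<Sum>k<2 ^ n. walsh k t * walsh k x) = (if \<lfloor>2 ^ n * t\<rfloor> = \<lfloor>2 ^ n * x\<rfloor> then 2 ^ n else 0)"
proof -
  have "(\<Sum>k<2 ^ n. walsh k t * walsh k x)
      = (\<Sum>k<2 ^ n. \<Prod>j<n. (rademacher j t * rademacher j x) ^ binary_digit j k)"
    by (rule sum.cong) (auto simp: walsh_eq_prod power_mult_distrib prod.distrib)
  also have "\<dots> = (\<Prod>j<n. 1 + rademacher j t * rademacher j x)"
    by (rule sum_prod_binary_digits)
  also have "\<dots> = (if \<lfloor>2 ^ n * t\<rfloor> = \<lfloor>2 ^ n * x\<rfloor> then 2 ^ n else 0)"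
  proof (induction n)
    case 0
    have "\<lfloor>x\<rfloor> = 0" "\<lfloor>t\<rfloor> = 0"
      using assms by (simp_all add: floor_eq_iff)
    then show ?case
      by simp
  next
    case (Suc n)
    have "1 + rademacher n t * rademacher n x = (if rademacher n t = rademacher n x then 2 else 0)"
      using rademacher_cases[of n x] rademacher_cases[of n t] by auto
    then show ?case
      using Suc by (auto simp: floor_power_Suc_eq_iff simp del: power_Suc) (simp add: power_Suc2)
  qed
  finally show ?thesis .
qed

definition cell_left :: "nat \<Rightarrow> real \<Rightarrow> real" where
  "cell_left n x = \<lfloor>2 ^ n * x\<rfloor> / 2 ^ n"

definition cell_right :: "nat \<Rightarrow> real \<Rightarrow> real" where
  "cell_right n x = (\<lfloor>2 ^ n * x\<rfloor> + 1) / 2 ^ n"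

lemma floor_eq_iff_cell:
  "\<lfloor>2 ^ n * t\<rfloor> = \<lfloor>2 ^ n * x\<rfloor> \<longleftrightarrow> cell_left n x \<le> t \<and> t < cell_right n x"
  by (simp add: floor_eq_iff cell_left_def cell_right_def pos_divide_le_eq pos_less_divide_eq mult.commute)

lemma cell_bounds:
  assumes "x \<in> {0..<1}"
  shows "0 \<le> cell_left n x" "cell_left n x \<le> x" "x < cell_right n x" "cell_right n x \<le> 1"
proof -
  show "cell_left n x \<le> x" "x < cell_right n x"
    using floor_eq_iff_cell[of n x x] by auto
  show "0 \<le> cell_left n x"
    using assms by (simp add: cell_left_def)
  have "2 ^ n * x < 2 ^ n"
    using assms by simp
  then have "\<lfloor>2 ^ n * x\<rfloor> < 2 ^ n"
    by (simp add: floor_less_iff)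
  then have "\<lfloor>2 ^ n * x\<rfloor> + 1 \<le> 2 ^ n"
    by linarith
  then have "real_of_int (\<lfloor>2 ^ n * x\<rfloor> + 1) \<le> real_of_int (2 ^ n)"
    by (simp only: of_int_le_iff)
  then show "cell_right n x \<le> 1"
    by (simp add: cell_right_def)
qed

lemma cell_length: "cell_right n x - cell_left n x = 1 / 2 ^ n"
  by (simp add: cell_left_def cell_right_def add_divide_distrib)

lemma walsh_measurable [measurable]: "walsh k \<in> borel_measurable borel"
proof -
  have "rademacher j \<in> borel_measurable borel" for j
    unfolding rademacher_def dyadic_digit_def by measurable
  then have "(\<lambda>x. \<Prod>j<k. rademacher j x ^ binary_digit j k) \<in> borel_measurable borel"
    by measurable
  then show ?thesis
    by (subst measurable_cong[OF walsh_eq_prod[OF less_exp]]) auto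
qed

lemma abs_walsh: "\<bar>walsh k x\<bar> = 1"
proof -
  have "\<bar>rademacher j x\<bar> = 1" for j
    using rademacher_cases[of j x] by auto
  then show ?thesis
    by (simp add: walsh_eq_prod[OF less_exp] abs_prod power_abs)
qed

lemma walsh_poly_measurable [measurable]: "walsh_poly m c \<in> borel_measurable borel"
  unfolding walsh_poly_def by measurable

lemma abs_walsh_poly_le: "\<bar>walsh_poly m c x\<bar> \<le> (\<Sum>k<m. \<bar>c k\<bar>)"
  unfolding walsh_poly_def by (rule order_trans[OF sum_abs]) (simp add: abs_mult abs_walsh)

lemma walsh_poly_cell_cong:
  assumes "\<lfloor>2 ^ n * x\<rfloor> = \<lfloor>2 ^ n * t\<rfloor>"
  shows "walsh_poly (2 ^ n) c x = walsh_poly (2 ^ n) c t"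
  unfolding walsh_poly_def
  using rademacher_eq_of_floor_eq[OF assms] by (intro sum.cong) (auto simp: walsh_eq_prod)

lemma walsh_psum_eq_poly: "walsh_psum m f = walsh_poly m (walsh_coeff f)"
  by (auto simp: walsh_psum_def walsh_poly_def)

lemma integrable01_mult_walsh_poly:
  assumes f: "integrable01 f"
  shows "integrable01 (\<lambda>t. f t * walsh_poly m c t)"
proof (rule set_integrable_bound)
  let ?C = "\<Sum>k<m. \<bar>c k\<bar>"
  show "integrable01 (\<lambda>t. ?C * f t)"
    using f by (rule set_integrable_mult_right)
  have "(\<lambda>t. indicator {0..<1} t *\<^sub>R f t) \<in> borel_measurable borel"
    using f borel_measurable_integrable unfolding set_integrable_def by fastforce
  then have "(\<lambda>t. (indicator {0..<1} t *\<^sub>R f t) * walsh_poly m c t) \<in> borel_measurable borel"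
    by measurable
  then show "set_borel_measurable lborel {0..<1} (\<lambda>t. f t * walsh_poly m c t)"
    unfolding set_borel_measurable_def by (simp add: mult.assoc)
  show "AE t in lborel. t \<in> {0..<1} \<longrightarrow> norm (f t * walsh_poly m c t) \<le> norm (?C * f t)"
  proof (intro AE_I2 impI)
    fix t
    have "\<bar>walsh_poly m c t\<bar> * \<bar>f t\<bar> \<le> \<bar>?C\<bar> * \<bar>f t\<bar>"
      using abs_walsh_poly_le[of m c t] by (intro mult_right_mono) auto
    then show "norm (f t * walsh_poly m c t) \<le> norm (?C * f t)"
      by (simp add: abs_mult mult.commute)
  qed
qed

lemma integrable01_walsh_poly: "integrable01 (walsh_poly m c)"
  using integrable01_mult_walsh_poly[OF integrable01_const[of 1]] by simp

text \<open>The partial sum of order \<open>2 ^ n\<close> is the conditional expectation with respect to the dyadic cells: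
  insert the Dirichlet kernel under the integral.\<close>

lemma walsh_psum_eq_mean:
  assumes f: "integrable01 f" and x: "x \<in> {0..<1}"
  shows "walsh_psum (2 ^ n) f x = 2 ^ n * (primitive f (cell_right n x) - primitive f (cell_left n x))"
proof -
  note cell = cell_bounds[OF x, of n]
  \<comment> \<open>A single Walsh function is a Walsh polynomial with one nonzero coefficient.\<close>
  have fw: "integrable01 (\<lambda>t. f t * walsh k t)" for k
    using integrable01_mult_walsh_poly[OF f, of "Suc k" "\<lambda>j. if j = k then 1 else 0"]
    by (simp add: walsh_poly_def if_distrib if_distribR cong: if_cong)
  have fww: "integrable01 (\<lambda>t. f t * walsh k t * walsh k x)" for k
    by (rule set_integrable_mult_left) (rule fw)
  have "walsh_psum (2 ^ n) f x = (\<Sum>k<2 ^ n. LBINT t:{0..<1}. f t * walsh k t * walsh k x)"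
    unfolding walsh_psum_def walsh_coeff_def by simp
  also have "\<dots> = (LBINT t:{0..<1}. \<Sum>k<2 ^ n. f t * walsh k t * walsh k x)"
    unfolding set_lebesgue_integral_def scaleR_sum_right
    by (intro Bochner_Integration.integral_sum[symmetric] fww[unfolded set_integrable_def])
  also have "\<dots> = (LBINT t:{0..<1}. f t * (\<Sum>k<2 ^ n. walsh k t * walsh k x))"
    by (simp add: sum_distrib_left mult.assoc)
  also have "\<dots> = (LBINT t:{cell_left n x..<cell_right n x}. 2 ^ n * f t)"
    unfolding set_lebesgue_integral_def
  proof (rule Bochner_Integration.integral_cong[OF refl])
    fix t
    show "indicator {0..<1} t *\<^sub>R (f t * (\<Sum>k<2 ^ n. walsh k t * walsh k x))
        = indicator {cell_left n x..<cell_right n x} t *\<^sub>R (2 ^ n * f t)"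
      using cell walsh_dirichlet_kernel[OF x, of t n] floor_eq_iff_cell[of n t x]
      by (auto simp: indicator_def)
  qed
  also have "\<dots> = 2 ^ n * (primitive f (cell_right n x) - primitive f (cell_left n x))"
    using cell by (simp add: primitive_increment[OF f])
  finally show ?thesis .
qed

section \<open>Integrals over dyadic cells\<close>

lemma eventually_cell_integrals_small:
  assumes f: "integrable01 f" and "\<delta> > 0"
  shows "\<forall>\<^sub>F n in sequentially. \<forall>x\<in>{0..<1}. primitive f (cell_right n x) - primitive f (cell_left n x) \<le> \<delta>"
proof -
  have "uniformly_continuous_on {0..1} (primitive f)"
    using continuous_on_primitive[OF f] by (rule compact_uniformly_continuous) simp
  then obtain d where d: "d > 0"
    "\<And>a b. a \<in> {0..1} \<Longrightarrow> b \<in> {0..1} \<Longrightarrow> dist b a < d \<Longrightarrow> dist (primitive f b) (primitive f a) < \<delta>"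
    using \<open>\<delta> > 0\<close> unfolding uniformly_continuous_on_def by metis
  have "(\<lambda>n. 1 / 2 ^ n :: real) \<longlonglongrightarrow> 0"
    by (rule LIMSEQ_divide_realpow_zero) simp
  then have "\<forall>\<^sub>F n in sequentially. 1 / 2 ^ n < d"
    using \<open>d > 0\<close> by (rule order_tendstoD)
  then show ?thesis
  proof eventually_elim
    case (elim n)
    show ?case
    proof
      fix x :: real assume x: "x \<in> {0..<1}"
      have "dist (primitive f (cell_right n x)) (primitive f (cell_left n x)) < \<delta>"
        by (rule d) (use cell_bounds[OF x, of n] cell_length[of n x] elim in \<open>auto simp: dist_real_def\<close>)
      then show "primitive f (cell_right n x) - primitive f (cell_left n x) \<le> \<delta>"
        by (simp add: dist_real_def)
    qed
  qed
qed

text \<open>Complete cells contribute nothing to the integral of \<open>h\<close> over \<open>[a, b]\<close>. What remains are the two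
  incomplete cells at the ends, which explains the factor \<open>2\<close>.\<close>

lemma primitive_increment_le_of_cell_mean_zero:
  assumes h: "integrable01 h"
    and mean: "\<And>x. x \<in> {0..<1} \<Longrightarrow> primitive h (cell_right n x) = primitive h (cell_left n x)"
    and le: "\<And>x. x \<in> {0..<1} \<Longrightarrow>
      primitive (\<lambda>t. \<bar>h t\<bar>) (cell_right n x) - primitive (\<lambda>t. \<bar>h t\<bar>) (cell_left n x) \<le> \<epsilon>"
    and ab: "a \<in> {0..<1}" "b \<in> {0..<1}"
  shows "\<bar>primitive h b - primitive h a\<bar> \<le> 2 * \<epsilon>"
proof -
  have h': "integrable01 (\<lambda>t. \<bar>h t\<bar>)"
    using h by (rule set_integrable_abs)
  have grid: "k \<le> 2 ^ n \<Longrightarrow> primitive h (real k / 2 ^ n) = 0" for k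
  proof (induction k)
    case (Suc k)
    then have "real k < 2 ^ n"
      by (metis Suc_le_lessD of_nat_less_iff of_nat_numeral of_nat_power)
    then have "real k / 2 ^ n \<in> {0..<1}"
      by simp
    from mean[OF this] show ?case
      using Suc by (simp add: cell_left_def cell_right_def add.commute)
  qed (simp add: primitive_zero)
  have small: "\<bar>primitive h x\<bar> \<le> \<epsilon>" if x: "x \<in> {0..<1}" for x
  proof -
    note cell = cell_bounds[OF x, of n]
    define k where "k = nat \<lfloor>2 ^ n * x\<rfloor>"
    have k: "cell_left n x = real k / 2 ^ n"
      using x by (simp add: k_def cell_left_def)
    have "real k / 2 ^ n < 1"
      using cell x unfolding k by (simp only: atLeastLessThan_iff)
    then have "real k < 2 ^ n"
      by (simp add: pos_divide_less_eq)
    then have "k \<le> 2 ^ n"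
      by (metis less_imp_le of_nat_less_iff of_nat_numeral of_nat_power)
    then have "primitive h (cell_left n x) = 0"
      by (simp add: k grid)
    moreover have "\<bar>primitive h x - primitive h (cell_left n x)\<bar>
        \<le> primitive (\<lambda>t. \<bar>h t\<bar>) x - primitive (\<lambda>t. \<bar>h t\<bar>) (cell_left n x)"
      by (rule abs_primitive_increment_le[OF h h']) (use cell x in auto)
    moreover have "\<bar>primitive h (cell_right n x) - primitive h x\<bar>
        \<le> primitive (\<lambda>t. \<bar>h t\<bar>) (cell_right n x) - primitive (\<lambda>t. \<bar>h t\<bar>) x"
      by (rule abs_primitive_increment_le[OF h h']) (use cell x in auto)
    ultimately show ?thesis
      using le[OF x] by linarith
  qed
  show ?thesis
    using small[OF ab(1)] small[OF ab(2)] by linarith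
qed

section \<open>The error estimate and convergence\<close>

text \<open>The quantitative core. Let \<open>u\<close> be the discrete solution, \<open>Q\<close> and \<open>R\<close> the cell means of \<open>q\<close> and
  \<open>p\<close>, and \<open>w = \<eta> + \<integral>\<^sub>\<xi> (Q - R u)\<close>. The equation for \<open>u\<close> says that \<open>u\<close> is the cell mean of
  the continuous function \<open>w\<close>. Everything is of order \<open>D = \<delta> (1 + B)\<close>: the oscillation of \<open>w\<close> on a
  cell, hence \<open>u - w\<close>; and the integral of \<open>h = (q - Q) - (p - R) u\<close>, which has mean zero on
  each cell because \<open>u\<close> is constant there. Subtracting the integral equation of \<open>y\<close> gives
  \<open>(w - y) + \<integral>\<^sub>\<xi> p (w - y) = \<integral>\<^sub>\<xi> p (w - u) - \<integral>\<^sub>\<xi> h\<close>, to which the stability estimate applies.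
  The a priori bound \<open>B\<close> on \<open>u\<close> may depend on \<open>n\<close>; since it enters the estimate only linearly and
  with the small factor \<open>\<delta>\<close>, it can be absorbed afterwards.\<close>

lemma discretization_error:
  fixes p q y :: "real \<Rightarrow> real" and c :: "nat \<Rightarrow> real"
  assumes \<xi>: "\<xi> \<in> {0..<1}"
    and p: "integrable01 p" "continuous_on {0..<1} p"
    and q: "integrable01 q"
    and y: "continuous_on {0..<1} y" "integrable01 (\<lambda>t. p t * y t)"
    and y_eq: "\<And>x. x \<in> {0..<1} \<Longrightarrow>
      y x = \<eta> + (primitive q x - primitive q \<xi>) - (primitive (\<lambda>t. p t * y t) x - primitive (\<lambda>t. p t * y t) \<xi>)"
    and sol: "solves_discretized_eq p q \<xi> \<eta> n (walsh_poly (2 ^ n) c)"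
    and B: "\<And>x. x \<in> {0..<1} \<Longrightarrow> \<bar>walsh_poly (2 ^ n) c x\<bar> \<le> B"
    and \<delta>p: "\<And>x. x \<in> {0..<1} \<Longrightarrow>
      primitive (\<lambda>t. \<bar>p t\<bar>) (cell_right n x) - primitive (\<lambda>t. \<bar>p t\<bar>) (cell_left n x) \<le> \<delta>"
    and \<delta>q: "\<And>x. x \<in> {0..<1} \<Longrightarrow>
      primitive (\<lambda>t. \<bar>q t\<bar>) (cell_right n x) - primitive (\<lambda>t. \<bar>q t\<bar>) (cell_left n x) \<le> \<delta>"
    and x: "x \<in> {0..<1}"
  defines "P \<equiv> primitive (\<lambda>t. \<bar>p t\<bar>) 1"
  shows "\<bar>walsh_poly (2 ^ n) c x - y x\<bar> \<le> (1 + (1 + P * exp (2 * P)) * (4 + P)) * (\<delta> * (1 + B))"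
proof -
  define u where "u = walsh_poly (2 ^ n) c"
  define Q where "Q = walsh_psum (2 ^ n) q"
  define R where "R = walsh_psum (2 ^ n) p"
  define g where "g t = Q t - R t * u t" for t
  define w where "w s = \<eta> + (primitive g s - primitive g \<xi>)" for s
  define h where "h t = q t - Q t - (p t - R t) * u t" for t
  define D where "D = \<delta> * (1 + B)"
  have B0: "B \<ge> 0"
    using B[OF \<xi>] by linarith
  have abs_int: "integrable01 (\<lambda>t. \<bar>p t\<bar>)" "integrable01 (\<lambda>t. \<bar>q t\<bar>)"
    using p q by (auto intro: set_integrable_abs)
  have ints: "integrable01 Q" "integrable01 (\<lambda>t. R t * u t)" "integrable01 (\<lambda>t. p t * u t)"
    unfolding Q_def R_def u_def walsh_psum_eq_poly
    by (intro integrable01_walsh_poly integrable01_mult_walsh_poly p)+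
  have g: "integrable01 g"
    unfolding g_def using ints by auto
  have h: "integrable01 h"
    unfolding h_def left_diff_distrib using ints q by auto

  have cell: "\<bar>Q x\<bar> / 2 ^ n \<le> \<delta>" "\<bar>R x\<bar> / 2 ^ n \<le> \<delta>"
    "Q x / 2 ^ n = primitive q (cell_right n x) - primitive q (cell_left n x)"
    "R x / 2 ^ n = primitive p (cell_right n x) - primitive p (cell_left n x)"
    if x: "x \<in> {0..<1}" for x
  proof -
    note b = cell_bounds[OF x, of n]
    show Q: "Q x / 2 ^ n = primitive q (cell_right n x) - primitive q (cell_left n x)"
      unfolding Q_def walsh_psum_eq_mean[OF q x] by simp
    show R: "R x / 2 ^ n = primitive p (cell_right n x) - primitive p (cell_left n x)"
      unfolding R_def walsh_psum_eq_mean[OF p(1) x] by simp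
    have "\<bar>Q x / 2 ^ n\<bar> \<le> \<delta>"
      unfolding Q by (rule order_trans[OF abs_primitive_increment_le \<delta>q[OF x]]) (use b q abs_int in auto)
    then show "\<bar>Q x\<bar> / 2 ^ n \<le> \<delta>"
      by simp
    have "\<bar>R x / 2 ^ n\<bar> \<le> \<delta>"
      unfolding R by (rule order_trans[OF abs_primitive_increment_le \<delta>p[OF x]]) (use b p abs_int in auto)
    then show "\<bar>R x\<bar> / 2 ^ n \<le> \<delta>"
      by simp
  qed
  have const: "u t = u x" "Q t = Q x" "R t = R x"
    if "cell_left n x \<le> t" "t < cell_right n x" for t x
  proof -
    have "\<lfloor>2 ^ n * t\<rfloor> = \<lfloor>2 ^ n * x\<rfloor>"
      using that floor_eq_iff_cell by blast
    then show "u t = u x" "Q t = Q x" "R t = R x"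
      unfolding u_def Q_def R_def walsh_psum_eq_poly by (intro walsh_poly_cell_cong; simp)+
  qed

  \<comment> \<open>On a cell \<open>g\<close> is a constant bounded by \<open>G\<close>, and \<open>G\<close> times the cell length is at most \<open>D\<close>.\<close>
  have oscillation: "\<bar>primitive g t - primitive g x\<bar> \<le> D"
    if x: "x \<in> {0..<1}" and t: "cell_left n x \<le> t" "t < cell_right n x" for t x
  proof -
    note b = cell_bounds[OF x, of n]
    define G where "G = \<bar>Q x\<bar> + \<bar>R x\<bar> * B"
    have G: "\<bar>g s\<bar> \<le> G" if "cell_left n x \<le> s" "s < cell_right n x" for s
    proof -
      have "\<bar>g s\<bar> \<le> \<bar>Q x\<bar> + \<bar>R x\<bar> * \<bar>u x\<bar>"
        unfolding g_def const[OF that] by (metis abs_mult abs_triangle_ineq4)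
      also have "\<dots> \<le> G"
        unfolding G_def using B[OF x] by (auto simp: u_def intro!: mult_left_mono)
      finally show ?thesis .
    qed
    have G0: "0 \<le> G"
      using B0 by (simp add: G_def)
    have *: "\<bar>primitive g b - primitive g a\<bar> \<le> G * (1 / 2 ^ n)"
      if ab: "cell_left n x \<le> a" "a \<le> b" "b < cell_right n x" for a b
    proof -
      have "\<bar>primitive g b - primitive g a\<bar> \<le> primitive (\<lambda>_. G) b - primitive (\<lambda>_. G) a"
        by (rule abs_primitive_increment_le[OF g integrable01_const]) (use G ab b in auto)
      also have "\<dots> = G * (b - a)"
        using ab b by (simp add: primitive_const right_diff_distrib)
      also have "\<dots> \<le> G * (1 / 2 ^ n)"
        using ab G0 by (intro mult_left_mono) (auto simp flip: cell_length[of n x])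
      finally show ?thesis .
    qed
    have "\<bar>primitive g t - primitive g x\<bar> \<le> G * (1 / 2 ^ n)"
      using *[of x t] *[of t x] t b by (cases "x \<le> t") auto
    also have "\<dots> = \<bar>Q x\<bar> / 2 ^ n + \<bar>R x\<bar> / 2 ^ n * B"
      by (simp add: G_def add_divide_distrib)
    also have "\<dots> \<le> \<delta> + \<delta> * B"
      using cell[OF x] B0 by (intro add_mono mult_right_mono) auto
    finally show ?thesis
      by (simp add: D_def distrib_left)
  qed

  \<comment> \<open>A cell mean differs from a value by at most the oscillation on the cell.\<close>
  have u_w: "\<bar>u x - w x\<bar> \<le> D" if x: "x \<in> {0..<1}" for x
  proof -
    note b = cell_bounds[OF x, of n]
    define F where "F s = primitive g s - primitive g \<xi>" for s
    have F: "integrable01 F"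
      unfolding F_def by (intro integrable01_continuous continuous_intros continuous_on_primitive g)
    have "(LBINT t=ereal \<xi>..ereal s. g t) = F s" if "s \<in> {0..<1}" for s
      unfolding F_def using that \<xi> by (intro interval_integral_eq_primitive g) auto
    then have "walsh_coeff (\<lambda>s. LBINT t=ereal \<xi>..ereal s. g t) = walsh_coeff F"
      unfolding walsh_coeff_def by (intro ext set_lebesgue_integral_cong) auto
    then have "u x = \<eta> + walsh_psum (2 ^ n) F x"
      using sol x unfolding solves_discretized_eq_def g_def Q_def R_def u_def walsh_psum_def by auto
    also have "walsh_psum (2 ^ n) F x = 2 ^ n * (primitive F (cell_right n x) - primitive F (cell_left n x))"
      by (rule walsh_psum_eq_mean[OF F x])
    finally have u_x: "u x = \<eta> + 2 ^ n * (primitive F (cell_right n x) - primitive F (cell_left n x))" .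
    have F_diff: "integrable01 (\<lambda>s. F s - F x)"
      using F integrable01_const by (rule set_integral_diff)
    have "\<bar>primitive (\<lambda>s. F s - F x) (cell_right n x) - primitive (\<lambda>s. F s - F x) (cell_left n x)\<bar>
        \<le> primitive (\<lambda>_. D) (cell_right n x) - primitive (\<lambda>_. D) (cell_left n x)"
      by (rule abs_primitive_increment_le[OF F_diff integrable01_const])
         (use b oscillation[OF x] in \<open>auto simp: F_def\<close>)
    also have "\<dots> = D * (1 / 2 ^ n)"
      using b by (simp add: primitive_const flip: right_diff_distrib cell_length[of n x])
    also have "primitive (\<lambda>s. F s - F x) (cell_right n x) - primitive (\<lambda>s. F s - F x) (cell_left n x)
        = primitive F (cell_right n x) - primitive F (cell_left n x) - F x * (cell_right n x - cell_left n x)"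
      using b by (simp add: primitive_diff[OF F integrable01_const] primitive_const right_diff_distrib)
    also have "\<dots> = (u x - w x) * (1 / 2 ^ n)"
      unfolding u_x w_def cell_length F_def[symmetric] by (simp add: field_simps)
    finally show ?thesis
      by (simp add: abs_mult divide_le_cancel)
  qed

  \<comment> \<open>The integral of \<open>\<bar>h\<bar>\<close> over one cell is at most \<open>2 * D\<close>: \<open>D\<close> from \<open>q\<close> and \<open>p u\<close>, and \<open>D\<close> from their means.\<close>
  have h_small: "\<bar>primitive h x - primitive h \<xi>\<bar> \<le> 2 * (2 * D)" if x: "x \<in> {0..<1}" for x
  proof (rule primitive_increment_le_of_cell_mean_zero[OF h _ _ \<xi> x])
    fix x :: real assume x: "x \<in> {0..<1}"
    note b = cell_bounds[OF x, of n]
    \<comment> \<open>The integrand \<open>h\<close> with \<open>u\<close>, \<open>Q\<close> and \<open>R\<close> frozen at their values on the cell.\<close>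
    let ?h = "\<lambda>t. (q t - Q x) - u x * (p t - R x)"
    have int1: "integrable01 (\<lambda>t. q t - Q x)" "integrable01 (\<lambda>t. p t - R x)"
      using p q integrable01_const by auto
    then have int2: "integrable01 (\<lambda>t. u x * (p t - R x))"
      by (intro set_integrable_mult_right)
    have int3: "integrable01 ?h"
      using int1(1) int2 by (rule set_integral_diff(1))
    have "primitive h (cell_right n x) - primitive h (cell_left n x)
        = primitive ?h (cell_right n x) - primitive ?h (cell_left n x)"
    proof (rule primitive_increment_cong[OF h int3])
      fix t assume t: "cell_left n x \<le> t" "t < cell_right n x"
      show "h t = ?h t"
        unfolding h_def const[OF t] by (simp add: mult.commute)
    qed (use b in auto)
    also have "\<dots> = (primitive q (cell_right n x) - primitive q (cell_left n x) - Q x * (cell_right n x - cell_left n x))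
        - u x * (primitive p (cell_right n x) - primitive p (cell_left n x) - R x * (cell_right n x - cell_left n x))"
      using b by (simp add: primitive_diff int1 int2 p q integrable01_const primitive_cmult primitive_const)
        (simp add: algebra_simps)
    also have "\<dots> = 0"
      unfolding cell_length using cell(3,4)[OF x] by simp
    finally show "primitive h (cell_right n x) = primitive h (cell_left n x)"
      by simp
    let ?k = "\<lambda>t. (\<bar>q t\<bar> + \<bar>Q x\<bar>) + B * (\<bar>p t\<bar> + \<bar>R x\<bar>)"
    have int4: "integrable01 (\<lambda>t. \<bar>q t\<bar> + \<bar>Q x\<bar>)" "integrable01 (\<lambda>t. \<bar>p t\<bar> + \<bar>R x\<bar>)"
      using abs_int integrable01_const by auto
    then have int5: "integrable01 (\<lambda>t. B * (\<bar>p t\<bar> + \<bar>R x\<bar>))"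
      by (intro set_integrable_mult_right)
    have int6: "integrable01 ?k"
      using int4(1) int5 by (rule set_integral_add(1))
    have "primitive (\<lambda>t. \<bar>h t\<bar>) (cell_right n x) - primitive (\<lambda>t. \<bar>h t\<bar>) (cell_left n x)
        \<le> primitive ?k (cell_right n x) - primitive ?k (cell_left n x)"
    proof (rule primitive_increment_mono[OF set_integrable_abs[OF h] int6])
      fix t assume t: "cell_left n x \<le> t" "t < cell_right n x"
      have "\<bar>u x * (p t - R x)\<bar> \<le> B * (\<bar>p t\<bar> + \<bar>R x\<bar>)"
        unfolding abs_mult using B[OF x] B0 by (intro mult_mono) (auto simp: u_def)
      moreover have "h t = ?h t"
        unfolding h_def const[OF t] by (simp add: mult.commute)
      ultimately show "\<bar>h t\<bar> \<le> ?k t"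
        by linarith
    qed (use b in auto)
    also have "\<dots> = (primitive (\<lambda>t. \<bar>q t\<bar>) (cell_right n x) - primitive (\<lambda>t. \<bar>q t\<bar>) (cell_left n x)
          + \<bar>Q x\<bar> * (cell_right n x - cell_left n x))
        + B * (primitive (\<lambda>t. \<bar>p t\<bar>) (cell_right n x) - primitive (\<lambda>t. \<bar>p t\<bar>) (cell_left n x)
          + \<bar>R x\<bar> * (cell_right n x - cell_left n x))"
      using b by (simp add: primitive_add int4 int5 abs_int integrable01_const primitive_cmult primitive_const)
        (simp add: algebra_simps)
    also have "\<dots> \<le> (\<delta> + \<delta>) + B * (\<delta> + \<delta>)"
      unfolding cell_length using cell(1,2)[OF x] \<delta>p[OF x] \<delta>q[OF x] B0
      by (intro add_mono mult_left_mono) auto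
    finally show "primitive (\<lambda>t. \<bar>h t\<bar>) (cell_right n x) - primitive (\<lambda>t. \<bar>h t\<bar>) (cell_left n x) \<le> 2 * D"
      by (simp add: D_def algebra_simps)
  qed

  \<comment> \<open>Boundedness of \<open>w\<close> makes \<open>p (w - y)\<close> integrable on the whole interval.\<close>
  have w_cont: "continuous_on {0..1} w"
    unfolding w_def by (intro continuous_intros continuous_on_primitive g)
  then have "bounded (w ` {0..1})"
    by (intro compact_imp_bounded compact_continuous_image) auto
  then obtain W where "\<And>t. t \<in> {0..1} \<Longrightarrow> \<bar>w t\<bar> \<le> W"
    unfolding bounded_iff by (auto simp only: real_norm_def ball_simps)
  then have pw: "integrable01 (\<lambda>t. p t * w t)"
    by (intro integrable01_mult_bounded_continuous[OF p(1), of _ W] continuous_on_subset[OF w_cont]) auto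
  then have pe: "integrable01 (\<lambda>t. p t * (w t - y t))"
    using y(2) by (simp add: right_diff_distrib set_integral_diff)
  have pwu: "integrable01 (\<lambda>t. p t * (w t - u t))"
    using pw ints by (simp add: right_diff_distrib set_integral_diff)
  have e: "\<bar>w x - y x\<bar> \<le> (1 + P * exp (2 * P)) * ((4 + P) * D)"
    unfolding P_def
  proof (rule volterra_stability[OF p \<xi> _ _ _ x,
        where g = "\<lambda>x. primitive (\<lambda>t. p t * (w t - y t)) x - primitive (\<lambda>t. p t * (w t - y t)) \<xi>"])
    fix x :: real assume x: "x \<in> {0..<1}"
    have "continuous_on {0..<1} (\<lambda>t. p t * (w t - y t))"
      by (intro continuous_intros p y continuous_on_subset[OF w_cont]) auto
    then show "((\<lambda>x. primitive (\<lambda>t. p t * (w t - y t)) x - primitive (\<lambda>t. p t * (w t - y t)) \<xi>)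
        has_real_derivative p x * (w x - y x)) (at x within {0..<1})"
      using primitive_has_derivative[OF pe _ x] by (auto intro!: derivative_eq_intros)
    \<comment> \<open>The pointwise identity behind this is \<open>p (w - u) - h = (Q - R u) - q + p y + p (w - y)\<close>.\<close>
    have split: "primitive (\<lambda>t. p t * (w t - u t)) s - primitive h s
        = primitive g s - primitive q s + primitive (\<lambda>t. p t * y t) s + primitive (\<lambda>t. p t * (w t - y t)) s"
      if s: "s \<in> {0..<1}" for s
    proof -
      have s: "0 \<le> s" "s \<le> 1"
        using s by auto
      have "primitive g s - primitive q s + primitive (\<lambda>t. p t * y t) s + primitive (\<lambda>t. p t * (w t - y t)) s
          = primitive (\<lambda>t. g t - q t + p t * y t + p t * (w t - y t)) s"
        using g q y(2) pe s by (simp add: primitive_diff primitive_add set_integral_diff set_integral_add)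
      also have "(\<lambda>t. g t - q t + p t * y t + p t * (w t - y t)) = (\<lambda>t. p t * (w t - u t) - h t)"
        by (simp add: g_def h_def algebra_simps)
      also have "primitive (\<lambda>t. p t * (w t - u t) - h t) s = primitive (\<lambda>t. p t * (w t - u t)) s - primitive h s"
        using pwu h s by (simp add: primitive_diff)
      finally show ?thesis ..
    qed
    have "\<bar>primitive (\<lambda>t. p t * (w t - u t)) x - primitive (\<lambda>t. p t * (w t - u t)) \<xi>\<bar> \<le> primitive (\<lambda>t. D * \<bar>p t\<bar>) 1"
    proof (rule primitive_increment_le_total[OF pwu])
      fix t :: real assume "0 \<le> t" "t < 1"
      then have "\<bar>w t - u t\<bar> * \<bar>p t\<bar> \<le> D * \<bar>p t\<bar>"
        using u_w[of t] by (intro mult_right_mono) auto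
      then show "\<bar>p t * (w t - u t)\<bar> \<le> D * \<bar>p t\<bar>"
        by (simp add: abs_mult mult.commute)
    qed (use abs_int x \<xi> in auto)
    also have "\<dots> = D * P"
      by (simp add: primitive_cmult P_def)
    finally have "\<bar>primitive (\<lambda>t. p t * (w t - u t)) x - primitive (\<lambda>t. p t * (w t - u t)) \<xi>\<bar> \<le> D * P" .
    moreover have "w x - y x + (primitive (\<lambda>t. p t * (w t - y t)) x - primitive (\<lambda>t. p t * (w t - y t)) \<xi>)
        = (primitive (\<lambda>t. p t * (w t - u t)) x - primitive (\<lambda>t. p t * (w t - u t)) \<xi>)
          - (primitive h x - primitive h \<xi>)"
      using split[OF x] split[OF \<xi>] y_eq[OF x] w_def[of x] by linarith
    moreover have "(4 + P) * D = 2 * (2 * D) + D * P"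
      by (simp add: algebra_simps)
    ultimately show "\<bar>w x - y x + (primitive (\<lambda>t. p t * (w t - y t)) x - primitive (\<lambda>t. p t * (w t - y t)) \<xi>)\<bar>
        \<le> (4 + primitive (\<lambda>t. \<bar>p t\<bar>) 1) * D"
      using h_small[OF x] unfolding P_def[symmetric] by linarith
  qed simp
  have "\<bar>u x - y x\<bar> \<le> D + (1 + P * exp (2 * P)) * ((4 + P) * D)"
    using e u_w[OF x] by linarith
  then show ?thesis
    unfolding u_def[symmetric] D_def[symmetric] by (simp add: algebra_simps)
qed

theorem theorem5p2:
  fixes \<xi> \<eta> :: real and p q y y' :: "real \<Rightarrow> real" and c :: "nat \<Rightarrow> nat \<Rightarrow> real"
  assumes "\<xi> \<in> {0..<1}"
    and "continuous_on {0..<1} p" and "set_integrable lborel {0..<1} p"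
    and "continuous_on {0..<1} q" and "set_integrable lborel {0..<1} q"
    and "\<And>x. x \<in> {0..<1} \<Longrightarrow> (y has_real_derivative y' x) (at x within {0..<1})"
    and "\<And>x. x \<in> {0..<1} \<Longrightarrow> y' x + p x * y x = q x"
    and "y \<xi> = \<eta>"
    and "\<forall>\<^sub>F n in sequentially. solves_discretized_eq p q \<xi> \<eta> n (walsh_poly (2 ^ n) (c n))"
  shows "uniform_limit {0..<1} (\<lambda>n. walsh_poly (2 ^ n) (c n)) y sequentially"
proof -
  note \<xi> = assms(1) and p = assms(3,2) and q = assms(5,4) and y' = assms(6)
  have y'_eq: "y' x = q x - p x * y x" if "x \<in> {0..<1}" for x
    using assms(7)[OF that] by linarith
  have abs_int: "integrable01 (\<lambda>t. \<bar>p t\<bar>)" "integrable01 (\<lambda>t. \<bar>q t\<bar>)"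
    using p q by (auto intro: set_integrable_abs)
  define P where "P = primitive (\<lambda>t. \<bar>p t\<bar>) 1"
  define Y where "Y = (1 + P * exp (2 * P)) * (\<bar>\<eta>\<bar> + primitive (\<lambda>t. \<bar>q t\<bar>) 1)"
  \<comment> \<open>The solution is bounded although \<open>p\<close> may be unbounded: \<open>y + \<integral>\<^sub>\<xi> p y = \<eta> + \<integral>\<^sub>\<xi> q\<close>.\<close>
  have y_bound: "\<bar>y x\<bar> \<le> Y" if x: "x \<in> {0..<1}" for x
    unfolding Y_def P_def
  proof (rule volterra_stability[OF p \<xi> _ _ _ x, where g = "\<lambda>x. (primitive q x - primitive q \<xi>) - (y x - \<eta>)"])
    fix x :: real assume x: "x \<in> {0..<1}"
    show "((\<lambda>x. (primitive q x - primitive q \<xi>) - (y x - \<eta>)) has_real_derivative p x * y x) (at x within {0..<1})"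
      using primitive_has_derivative[OF q x] y'[OF x] y'_eq[OF x] by (auto intro!: derivative_eq_intros)
    have "\<bar>primitive q x - primitive q \<xi>\<bar> \<le> primitive (\<lambda>t. \<bar>q t\<bar>) 1"
      by (rule primitive_increment_le_total) (use q abs_int x \<xi> in auto)
    then show "\<bar>y x + ((primitive q x - primitive q \<xi>) - (y x - \<eta>))\<bar> \<le> \<bar>\<eta>\<bar> + primitive (\<lambda>t. \<bar>q t\<bar>) 1"
      by linarith
  qed (simp add: assms(8))
  have y_cont: "continuous_on {0..<1} y"
    using y' by (rule DERIV_continuous_on)
  have py: "integrable01 (\<lambda>t. p t * y t)"
    using p(1) y_cont y_bound by (rule integrable01_mult_bounded_continuous)
  \<comment> \<open>Integral form of the Cauchy problem; boundedness of \<open>y\<close> makes \<open>p y\<close> integrable.\<close>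
  have deriv_zero: "((\<lambda>x. y x + primitive (\<lambda>t. p t * y t) x - primitive q x) has_real_derivative 0) (at x within {0..<1})"
    if x: "x \<in> {0..<1}" for x
    using primitive_has_derivative[OF q x] y'[OF x] y'_eq[OF x]
      primitive_has_derivative[OF py continuous_on_mult[OF p(2) y_cont] x]
    by (auto intro!: derivative_eq_intros)
  have "\<exists>k. \<forall>x\<in>{0..<1}. y x + primitive (\<lambda>t. p t * y t) x - primitive q x = k"
    by (rule has_field_derivative_zero_constant[OF _ deriv_zero]) simp_all
  then obtain k where k: "\<And>x. x \<in> {0..<1} \<Longrightarrow> y x + primitive (\<lambda>t. p t * y t) x - primitive q x = k"
    by blast
  have y_eq: "y x = \<eta> + (primitive q x - primitive q \<xi>) - (primitive (\<lambda>t. p t * y t) x - primitive (\<lambda>t. p t * y t) \<xi>)"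
    if "x \<in> {0..<1}" for x
    using k[OF that] k[OF \<xi>] assms(8) by linarith

  have P0: "P \<ge> 0"
    using primitive_increment_le_total[OF p(1) abs_int(1), of 0 0] by (simp add: P_def)
  have Y0: "Y \<ge> 0"
    using y_bound[OF \<xi>] by linarith
  define K where "K = 1 + (1 + P * exp (2 * P)) * (4 + P)"
  have K: "K > 0"
    using P0 by (auto simp: K_def intro!: add_pos_nonneg)
  show ?thesis
  proof (rule uniform_limitI)
    fix \<epsilon> :: real assume \<epsilon>: "\<epsilon> > 0"
    \<comment> \<open>The first bound yields the \<open>n\<close>-independent estimate \<open>1 + U \<le> 2 * Y + 2\<close> for the supremum \<open>U\<close> of \<open>\<bar>u\<bar>\<close>,
         the second one turns it into an error of at most \<open>\<epsilon> / 2\<close>.\<close>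
    define \<delta> where "\<delta> = min (1 / 2) (\<epsilon> / (2 * (2 * Y + 2))) / K"
    have "K * \<delta> = min (1 / 2) (\<epsilon> / (2 * (2 * Y + 2)))"
      using K by (simp add: \<delta>_def)
    then have \<delta>: "\<delta> > 0" "K * \<delta> \<le> 1 / 2" "K * \<delta> \<le> \<epsilon> / (2 * (2 * Y + 2))"
      using \<epsilon> K Y0 by (simp_all only: min.cobounded1 min.cobounded2) (simp add: \<delta>_def)
    show "\<forall>\<^sub>F n in sequentially. \<forall>x\<in>{0..<1}. dist (walsh_poly (2 ^ n) (c n) x) (y x) < \<epsilon>"
      using assms(9) eventually_cell_integrals_small[OF abs_int(1) \<delta>(1)]
        eventually_cell_integrals_small[OF abs_int(2) \<delta>(1)]
    proof eventually_elim
      case (elim n)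
      define u where "u = walsh_poly (2 ^ n) (c n)"
      define U where "U = (SUP x\<in>{0..<1}. \<bar>u x\<bar>)"
      have "bdd_above ((\<lambda>x. \<bar>u x\<bar>) ` {0..<1})"
        unfolding u_def by (rule bdd_aboveI2[OF abs_walsh_poly_le])
      then have U: "\<bar>u x\<bar> \<le> U" if "x \<in> {0..<1}" for x
        unfolding U_def using that by (rule cSUP_upper2) auto
      have err: "\<bar>u x - y x\<bar> \<le> K * \<delta> * (1 + U)" if "x \<in> {0..<1}" for x
        unfolding u_def K_def P_def mult.assoc
        by (rule discretization_error[OF \<xi> p q(1) y_cont py y_eq elim(1) U[unfolded u_def] _ _ that])
           (use elim in auto)
      have "0 \<le> U"
        using U[OF \<xi>] by linarith
      have U_le: "U \<le> Y + K * \<delta> * (1 + U)"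
        unfolding U_def
      proof (rule cSUP_least)
        fix x :: real assume "x \<in> {0..<1}"
        from err[OF this] y_bound[OF this]
        show "\<bar>u x\<bar> \<le> Y + K * \<delta> * (1 + (SUP x\<in>{0..<1}. \<bar>u x\<bar>))"
          unfolding U_def by linarith
      qed simp
      have "K * \<delta> * (1 + U) \<le> 1 / 2 * (1 + U)"
        using \<delta> \<open>0 \<le> U\<close> by (intro mult_right_mono) auto
      from order_trans[OF U_le add_left_mono[OF this]] have "1 + U \<le> 2 * Y + 2"
        by (simp add: field_simps)
      then have "K * \<delta> * (1 + U) \<le> \<epsilon> / (2 * (2 * Y + 2)) * (2 * Y + 2)"
        using \<delta> \<epsilon> Y0 \<open>0 \<le> U\<close> by (intro mult_mono) auto
      also have "\<dots> = \<epsilon> / 2"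
        using Y0 by (simp add: field_simps)
      also have "\<dots> < \<epsilon>"
        using \<epsilon> by simp
      finally show ?case
        using err by (fastforce simp: dist_real_def u_def)
    qed
  qed
qed

end
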